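(* Fix $\tau>0$ and let $f_\tau(X)=\tau\|X\|_*+\frac12\|X\|_F^2$ for $X\in\mathbb{R}^{n_1\times n_2}$. Let $f_1,\dots,f_m:\mathbb{R}^{n_1\times n_2}\to\mathbb{R}$ be convex, put $\mathcal{F}(X)=(f_1(X),\dots,f_m(X))$, and assume that $\mathcal{F}$ is Lipschitz, i.e. $$\|\mathcal{F}(X)-\mathcal{F}(Y)\|\le L(\mathcal{F})\,\|X-Y\|_F\quad\text{for all }X,Y\in\mathbb{R}^{n_1\times n_2},$$ for some constant $L(\mathcal{F})\ge0$. Consider the problem $$\text{minimize } \ f_\tau(X)\quad\text{subject to } f_i(X)\le0,\ i=1,\dots,m,$$ and assume that strong duality holds for it. Let the sequence of step sizes obey $0<\inf_k\delta_k\le\sup_k\delta_k<2/L(\mathcal{F})^2$. Starting with $y^0=0\in\mathbb{R}^m$, define inductively for $k=1,2,\dots$ $$X^k=\arg\min_X\,\{f_\tau(X)+\langle y^{k-1},\mathcal{F}(X)\rangle\},\qquad y^k=[y^{k-1}+\delta_k\,\mathcal{F}(X^k)]_+.$$ Then the sequence $\{X^k\}$ converges to the unique solution of the problem of minimizing $f_\tau(X)$ over $X\in\mathbb{R}^{n_1\times n_2}$ subject to $f_i(X)\le0$, $i=1,\dots,m$.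
   Context: $\|X\|_*$ is the nuclear norm (sum of singular values), $\|X\|_F$ the Frobenius norm, and $\|\cdot\|$ on $\mathbb{R}^m$ the Euclidean norm. For $x\in\mathbb{R}^m$, $[x]_+$ is the vector with entries $\max(x_i,0)$, and $x\ge0$ means all components are nonnegative. If $L(\mathcal{F})=0$, then $2/L(\mathcal{F})^2$ is read as $+\infty$. The Lagrangian is $\mathcal{L}(X,y)=f_\tau(X)+\langle y,\mathcal{F}(X)\rangle$ for $X\in\mathbb{R}^{n_1\times n_2}$ and $y\in\mathbb{R}^m$, $y\ge0$. Strong duality is understood in the sense that there exists a primal-dual optimal pair, i.e. a saddlepoint $(X^\star,y^\star)$ with $y^\star\ge0$ such that $\mathcal{L}(X^\star,y)\le\mathcal{L}(X^\star,y^\star)\le\mathcal{L}(X,y^\star)$ for all $X\in\mathbb{R}^{n_1\times n_2}$ and all $y\ge0$. *)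

theory Defs
  imports "HOL-Analysis.Analysis"
begin

text \<open>
  A real \<open>n\<^sub>1 \<times> n\<^sub>2\<close> matrix is an element of \<^typ>\<open>real^'n2^'n1\<close>. The library norm of this type,
  the Euclidean norm of the vector of Euclidean norms of the rows, is the Frobenius norm, and
  \<open>0 \<le> y\<close> on \<^typ>\<open>real^'m\<close> is the componentwise order.
\<close>

definition right_singular_space :: "real^'n2^'n1 \<Rightarrow> real \<Rightarrow> (real^'n2) set" where
  "right_singular_space X s = {v. (transpose X ** X) *v v = s\<^sup>2 *\<^sub>R v}"

text \<open>
  The singular values are the nonnegative square roots of the eigenvalues of \<open>X\<^sup>T X\<close>, and the
  multiplicity of \<open>s\<close> is the dimension of the eigenspace for \<open>s\<^sup>2\<close>; algebraic and geometric
  multiplicities agree since \<open>X\<^sup>T X\<close> is symmetric. All \<open>n\<^sub>2\<close> values are counted, which differs from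
  counting \<open>min n\<^sub>1 n\<^sub>2\<close> of them only in zeros.
\<close>

definition singular_values :: "real^'n2^'n1 \<Rightarrow> real set" where
  "singular_values X = {s. 0 \<le> s \<and> (\<exists>v. v \<noteq> 0 \<and> v \<in> right_singular_space X s)}"

definition nuclear_norm :: "real^'n2^'n1 \<Rightarrow> real" where
  "nuclear_norm X = (\<Sum>s\<in>singular_values X. real (dim (right_singular_space X s)) * s)"

text \<open>The sum above is over a finite set, so it is never the default value for infinite sums.\<close>

lemma right_singular_space_orthogonal:
  assumes v: "v \<in> right_singular_space X s" and w: "w \<in> right_singular_space X t"
    and "0 \<le> s" "0 \<le> t" "s \<noteq> t"
  shows "v \<bullet> w = 0"
proof -
  have "s\<^sup>2 * (v \<bullet> w) = ((transpose X ** X) *v v) \<bullet> w"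
    using v by (simp add: right_singular_space_def)
  also have "\<dots> = v \<bullet> ((transpose X ** X) *v w)"
    by (simp add: dot_lmul_matrix[symmetric] vector_transpose_matrix matrix_transpose_mul
        flip: transpose_matrix_vector)
  also have "\<dots> = t\<^sup>2 * (v \<bullet> w)"
    using w by (simp add: right_singular_space_def)
  finally have "s\<^sup>2 * (v \<bullet> w) = t\<^sup>2 * (v \<bullet> w)" .
  moreover have "s\<^sup>2 \<noteq> t\<^sup>2"
    using assms by (simp add: power2_eq_iff_nonneg)
  ultimately show ?thesis by simp
qed

lemma finite_singular_values: "finite (singular_values X)"
proof -
  have "\<forall>s\<in>singular_values X. \<exists>v. v \<noteq> 0 \<and> v \<in> right_singular_space X s"
    by (auto simp: singular_values_def)
  then obtain v where v: "\<And>s. s \<in> singular_values X \<Longrightarrow> v s \<noteq> 0 \<and> v s \<in> right_singular_space X s"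
    by metis
  have orth: "v s \<bullet> v t = 0" if "s \<in> singular_values X" "t \<in> singular_values X" "s \<noteq> t" for s t
    using right_singular_space_orthogonal[of "v s" X s "v t" t] v that
    by (auto simp: singular_values_def)
  have "inj_on v (singular_values X)"
    by (rule inj_onI) (metis orth v inner_eq_zero_iff)
  moreover have "independent (v ` singular_values X)"
    by (rule pairwise_orthogonal_independent) (use v orth in \<open>auto simp: pairwise_def orthogonal_def\<close>)
  ultimately show ?thesis
    using finite_imageD independent_imp_finite by blast
qed

definition f_tau :: "real \<Rightarrow> real^'n2^'n1 \<Rightarrow> real" where
  "f_tau \<tau> X = \<tau> * nuclear_norm X + (1 / 2) * (norm X)\<^sup>2"

definition constraint_map :: "('m \<Rightarrow> real^'n2^'n1 \<Rightarrow> real) \<Rightarrow> real^'n2^'n1 \<Rightarrow> real^'m" where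
  "constraint_map f X = (\<chi> i. f i X)"

definition lagrangian ::
  "real \<Rightarrow> ('m::finite \<Rightarrow> real^'n2^'n1 \<Rightarrow> real) \<Rightarrow> real^'n2^'n1 \<Rightarrow> real^'m \<Rightarrow> real" where
  "lagrangian \<tau> f X y = f_tau \<tau> X + y \<bullet> constraint_map f X"

definition strong_duality ::
  "real \<Rightarrow> ('m::finite \<Rightarrow> real^'n2^'n1 \<Rightarrow> real) \<Rightarrow> bool" where
  "strong_duality \<tau> f \<longleftrightarrow>
     (\<exists>Xs ys. 0 \<le> ys \<and>
        (\<forall>X y. 0 \<le> y \<longrightarrow>
           lagrangian \<tau> f Xs y \<le> lagrangian \<tau> f Xs ys \<and>
           lagrangian \<tau> f Xs ys \<le> lagrangian \<tau> f X ys))"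

definition is_solution ::
  "real \<Rightarrow> ('m \<Rightarrow> real^'n2^'n1 \<Rightarrow> real) \<Rightarrow> real^'n2^'n1 \<Rightarrow> bool" where
  "is_solution \<tau> f = is_arg_min (f_tau \<tau>) (\<lambda>X. \<forall>i. f i X \<le> 0)"

definition pos_part :: "real^'m \<Rightarrow> real^'m" where
  "pos_part x = (\<chi> i. max (x $ i) 0)"

end

theory Submission
  imports Defs
begin

text \<open>
  The iteration is projected gradient ascent on the dual problem, and it converges because
  the primal objective is strongly convex. The term \<open>\<tau> * nuclear_norm Z\<close> is convex, so for
  \<open>y \<ge> 0\<close> the Lagrangian is a convex function of \<open>Z\<close> plus half the squared Frobenius norm.
  Such a function has a minimizer and exceeds its minimum by at least half the squared distance
  to it (\<open>lagrangian_quadratic_growth\<close>).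

  Let \<open>(Xs, ys)\<close> be a saddle point. The growth inequality at \<open>X k\<close>, tested at \<open>Xs\<close>, and the one
  at \<open>Xs\<close>, tested at \<open>X k\<close>, add up to
  \<open>\<langle>y (k - 1) - ys, F (X k) - F Xs\<rangle> \<le> - \<parallel>X k - Xs\<parallel>\<^sup>2\<close>, where \<open>F\<close> is the constraint map.
  Complementary slackness makes \<open>ys\<close> a fixed point of the multiplier update at \<open>Xs\<close>, and the
  positive part is nonexpansive. Expanding the square and using that \<open>F\<close> is Lipschitz gives
  \<open>\<parallel>y k - ys\<parallel>\<^sup>2 + \<delta> k * (2 - \<delta> k * L\<^sup>2) * \<parallel>X k - Xs\<parallel>\<^sup>2 \<le> \<parallel>y (k - 1) - ys\<parallel>\<^sup>2\<close>
  (\<open>dual_step_distance\<close>). The step size bounds keep the factor of the middle term away from \<open>0\<close>.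
  The distances of the multipliers to \<open>ys\<close> decrease and therefore converge, which forces
  \<open>\<parallel>X k - Xs\<parallel>\<close> to \<open>0\<close>.

  Convexity of the nuclear norm is read off from its dual description: it is the maximum of the
  linear functionals \<open>W \<bullet> X\<close> over the contractions \<open>W\<close>. This rests on rewriting the sum over
  singular values as \<open>\<Sum>b\<in>B. norm (X *v b)\<close> for an orthonormal basis \<open>B\<close> of right singular
  vectors (\<open>nuclear_norm_singular_basis\<close>), that is, on the spectral theorem for \<open>X\<^sup>T X\<close>.
\<close>

section \<open>The nuclear norm\<close>

lemma inner_gram_matrix:
  fixes A :: "real^'n2^'n1"
  shows "((transpose A ** A) *v v) \<bullet> w = (A *v v) \<bullet> (A *v w)"
  by (metis dot_lmul_matrix matrix_vector_mul_assoc transpose_matrix_vector)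

lemma subspace_right_singular_space: "subspace (right_singular_space X s)"
  by (auto simp: subspace_def right_singular_space_def matrix_vector_right_distrib
      scaleR_right_distrib matrix_vector_mult_scaleR)

lemma norm_matrix_right_singular_vector:
  assumes "v \<in> right_singular_space X s" "0 \<le> s"
  shows "norm (X *v v) = s * norm v"
proof -
  have "(norm (X *v v))\<^sup>2 = (s * norm v)\<^sup>2"
    using assms inner_gram_matrix[of X v v]
    by (simp add: right_singular_space_def power2_norm_eq_inner power_mult_distrib)
  then show ?thesis
    using assms by (simp add: power2_eq_iff_nonneg)
qed

text \<open>
  The first-order condition at a maximum: near \<open>t = 0\<close> the linear term dominates the quadratic one.
\<close>

lemma linear_term_zero_if_quadratic_nonpos:
  fixes a b :: real
  assumes "\<And>t. 2 * t * a + t\<^sup>2 * b \<le> 0"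
  shows "a = 0"
proof (rule ccontr)
  assume "a \<noteq> 0"
  \<comment> \<open>With this \<open>t\<close> the quadratic is \<open>t\<^sup>2\<close> times a number that is at least \<open>2 + \<bar>b\<bar>\<close>.\<close>
  define t where "t = a / (1 + \<bar>b\<bar>)"
  have "2 * t * a + t\<^sup>2 * b = t\<^sup>2 * (2 * (1 + \<bar>b\<bar>) + b)"
    unfolding t_def by (simp add: divide_simps power2_eq_square) (simp add: algebra_simps)
  moreover have "t \<noteq> 0" using \<open>a \<noteq> 0\<close> by (simp add: t_def)
  moreover have "2 * (1 + \<bar>b\<bar>) + b > 0" using abs_ge_minus_self[of b] abs_ge_zero[of b] by argo
  ultimately have "2 * t * a + t\<^sup>2 * b > 0" by simp
  with assms[of t] show False by simp
qed

text \<open>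
  The variational step of the spectral theorem. A maximizer \<open>v\<close> of \<open>norm (X *v v)\<close> on the unit
  sphere of \<open>V\<close> is an eigenvector of \<open>X\<^sup>T X\<close>: with \<open>s\<close> the maximal value, the residual
  \<open>X\<^sup>T X v - s\<^sup>2 v\<close> is orthogonal to \<open>V\<close> by stationarity, and it lies in \<open>V\<close> by invariance.
\<close>

lemma exists_singular_vector_in_invariant_subspace:
  fixes X :: "real^'n2^'n1"
  assumes V: "subspace V" and inv: "\<And>v. v \<in> V \<Longrightarrow> (transpose X ** X) *v v \<in> V"
    and ne: "V \<noteq> {0}"
  obtains s v where "0 \<le> s" "v \<in> V" "norm v = 1" "v \<in> right_singular_space X s"
proof -
  let ?K = "sphere 0 1 \<inter> V"
  have "compact ?K"
    using closed_subspace[OF V] by (simp add: compact_Int_closed)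
  moreover obtain u where "u \<in> V" "u \<noteq> 0"
    using ne subspace_0[OF V] by auto
  then have "(1 / norm u) *\<^sub>R u \<in> ?K"
    using V by (simp add: subspace_scale)
  moreover have "continuous_on ?K (\<lambda>v. norm (X *v v))"
    by (intro continuous_intros)
  ultimately obtain v where v: "v \<in> ?K" and max: "\<And>w. w \<in> ?K \<Longrightarrow> norm (X *v w) \<le> norm (X *v v)"
    using continuous_attains_sup[of ?K "\<lambda>v. norm (X *v v)"] by (metis empty_iff)
  define s where "s = norm (X *v v)"
  have bound: "norm (X *v w) \<le> s * norm w" if "w \<in> V" for w
  proof (cases "w = 0")
    case False
    with that V have "(1 / norm w) *\<^sub>R w \<in> ?K" by (simp add: subspace_scale)
    from max[OF this] False show ?thesis
      by (simp add: matrix_vector_mult_scaleR s_def divide_simps mult.commute)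
  qed simp
  let ?r = "(transpose X ** X) *v v - s\<^sup>2 *\<^sub>R v"
  have v1: "v \<in> V" "v \<bullet> v = 1" using v by (auto simp: norm_eq_1)
  have orth: "?r \<bullet> w = 0" if w: "w \<in> V" for w
  proof (rule linear_term_zero_if_quadratic_nonpos)
    fix t :: real
    have "v + t *\<^sub>R w \<in> V" using v1 w V by (simp add: subspace_add subspace_scale)
    from power_mono[OF bound[OF this], of 2]
    have "(X *v v + t *\<^sub>R (X *v w)) \<bullet> (X *v v + t *\<^sub>R (X *v w))
        \<le> s\<^sup>2 * ((v + t *\<^sub>R w) \<bullet> (v + t *\<^sub>R w))"
      by (simp add: power_mult_distrib power2_norm_eq_inner matrix_vector_right_distrib
          matrix_vector_mult_scaleR)
    moreover have "(X *v v) \<bullet> (X *v v) = s\<^sup>2"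
      by (simp add: s_def power2_norm_eq_inner)
    ultimately show "2 * t * (?r \<bullet> w) + t\<^sup>2 * ((X *v w) \<bullet> (X *v w) - s\<^sup>2 * (w \<bullet> w)) \<le> 0"
      using v1 by (simp add: inner_diff_left inner_gram_matrix inner_add_left inner_add_right
          inner_commute[of w v] inner_commute[of "X *v w" "X *v v"] power2_eq_square algebra_simps)
  qed
  have "?r \<in> V" using v1 V inv by (simp add: subspace_diff subspace_scale)
  then have "?r = 0" using orth inner_eq_zero_iff by blast
  then have "v \<in> right_singular_space X s" by (simp add: right_singular_space_def)
  then show ?thesis using that[of s v] v by (simp add: s_def)
qed

text \<open>
  The basis is the union of orthonormal bases of the spaces \<open>right_singular_space X s\<close>. A basis
  vector for \<open>s\<close> satisfies \<open>norm (X *v b) = s\<close>, and there are as many of them as the dimension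
  of the space, which matches the nuclear norm term by term. The union spans because the
  orthogonal complement of its span is invariant under \<open>X\<^sup>T X\<close>: if it were nonzero, it would
  contain another right singular vector.
\<close>

lemma nuclear_norm_singular_basis:
  fixes X :: "real^'n2^'n1"
  obtains B where "finite B" "pairwise orthogonal B" "\<And>b. b \<in> B \<Longrightarrow> norm b = 1" "span B = UNIV"
    "pairwise (\<lambda>b c. orthogonal (X *v b) (X *v c)) B"
    "nuclear_norm X = (\<Sum>b\<in>B. norm (X *v b))"
proof -
  let ?E = "right_singular_space X" and ?S = "singular_values X"
  have "\<exists>B. B \<subseteq> ?E s \<and> pairwise orthogonal B \<and> (\<forall>b\<in>B. norm b = 1) \<and> finite B \<and>
      card B = dim (?E s) \<and> span B = ?E s" for s
    using orthonormal_basis_subspace[OF subspace_right_singular_space[of X s]]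
    by (metis independent_imp_finite)
  then obtain D where D: "\<And>s. D s \<subseteq> ?E s" "\<And>s. pairwise orthogonal (D s)"
    "\<And>s b. b \<in> D s \<Longrightarrow> norm b = 1" "\<And>s. finite (D s)" "\<And>s. card (D s) = dim (?E s)"
    "\<And>s. span (D s) = ?E s"
    by metis
  define B where "B = (\<Union>s\<in>?S. D s)"
  have S0: "0 \<le> s" if "s \<in> ?S" for s using that by (simp add: singular_values_def)
  have cross: "b \<bullet> c = 0" if "b \<in> D s" "c \<in> D t" "s \<in> ?S" "t \<in> ?S" "s \<noteq> t" for b c s t
    using right_singular_space_orthogonal[of b X s c t] D(1) that S0 by blast
  have fin: "finite B" unfolding B_def by (intro finite_UN_I finite_singular_values D(4))
  have unit: "norm b = 1" if "b \<in> B" for b using that D by (auto simp: B_def)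
  have orth: "pairwise orthogonal B"
    unfolding B_def pairwise_def orthogonal_def
    using cross D(2) by (force simp: pairwise_def orthogonal_def)
  have eig: "(transpose X ** X) *v b = s\<^sup>2 *\<^sub>R b" if "b \<in> D s" for b s
    using D(1) that by (auto simp: right_singular_space_def)
  have images: "pairwise (\<lambda>b c. orthogonal (X *v b) (X *v c)) B"
    unfolding pairwise_def
  proof (intro ballI impI)
    fix b c assume "b \<in> B" "c \<in> B" "b \<noteq> c"
    then obtain s where "b \<in> D s" by (auto simp: B_def)
    have "b \<bullet> c = 0" using orth \<open>b \<in> B\<close> \<open>c \<in> B\<close> \<open>b \<noteq> c\<close> by (simp add: pairwise_def orthogonal_def)
    then show "orthogonal (X *v b) (X *v c)"
      using inner_gram_matrix[of X b c] eig[OF \<open>b \<in> D s\<close>] by (simp add: orthogonal_def)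
  qed
  have span: "span B = UNIV"
  proof (rule ccontr)
    assume "span B \<noteq> UNIV"
    let ?V = "{v. \<forall>b\<in>B. v \<bullet> b = 0}"
    have "subspace ?V" by (auto simp: subspace_def inner_add_left)
    moreover have "(transpose X ** X) *v v \<in> ?V" if "v \<in> ?V" for v
    proof clarify
      fix b assume "b \<in> B"
      then obtain s where "b \<in> D s" by (auto simp: B_def)
      have "((transpose X ** X) *v v) \<bullet> b = v \<bullet> ((transpose X ** X) *v b)"
        by (metis inner_gram_matrix inner_commute)
      then show "((transpose X ** X) *v v) \<bullet> b = 0"
        using that \<open>b \<in> B\<close> eig[OF \<open>b \<in> D s\<close>] by simp
    qed
    moreover have "?V \<noteq> {0}"
    proof -
      have "span B \<subset> UNIV" using \<open>span B \<noteq> UNIV\<close> by blast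
      then obtain x where "x \<noteq> 0" "\<And>z. z \<in> span B \<Longrightarrow> orthogonal x z"
        using orthogonal_to_subspace_exists_gen[of B UNIV] by auto
      then have "x \<in> ?V" by (auto simp: orthogonal_def span_base)
      with \<open>x \<noteq> 0\<close> show ?thesis by blast
    qed
    ultimately obtain s v where sv: "0 \<le> s" "v \<in> ?V" "norm v = 1" "v \<in> ?E s"
      using exists_singular_vector_in_invariant_subspace[of ?V X] by blast
    then have "s \<in> ?S" by (auto simp: singular_values_def intro!: exI[of _ v])
    then have "span (D s) \<subseteq> span B" by (intro span_mono) (auto simp: B_def)
    then have "v \<in> span B" using sv D(6) by auto
    then have "orthogonal v v"
      by (rule orthogonal_to_span) (use sv in \<open>auto simp: orthogonal_def\<close>)
    then show False using sv by (simp add: orthogonal_def)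
  qed
  have "(\<Sum>b\<in>B. norm (X *v b)) = (\<Sum>s\<in>?S. \<Sum>b\<in>D s. norm (X *v b))"
    unfolding B_def
  proof (rule sum.UNION_disjoint)
    show "\<forall>s\<in>?S. \<forall>t\<in>?S. s \<noteq> t \<longrightarrow> D s \<inter> D t = {}"
      using cross D(3) by (metis disjoint_iff inner_eq_zero_iff norm_zero zero_neq_one)
  qed (use finite_singular_values D in auto)
  also have "\<dots> = (\<Sum>s\<in>?S. \<Sum>b\<in>D s. s)"
  proof (intro sum.cong refl)
    fix s b assume "s \<in> ?S" "b \<in> D s"
    then show "norm (X *v b) = s"
      using norm_matrix_right_singular_vector[of b X s] D(1,3) S0 by fastforce
  qed
  also have "\<dots> = nuclear_norm X"
    by (simp add: nuclear_norm_def D(5))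
  finally show ?thesis using that[OF fin orth unit span images] by simp
qed

text \<open>
  The Frobenius inner product does not depend on the orthonormal basis in which it is computed:
  this is Parseval's identity applied to each pair of rows.
\<close>

lemma inner_matrix_orthonormal_basis:
  fixes W Y :: "real^'n2^'n1"
  assumes B: "finite B" "pairwise orthogonal B" "\<And>b. b \<in> B \<Longrightarrow> norm b = 1" "span B = UNIV"
  shows "W \<bullet> Y = (\<Sum>b\<in>B. (W *v b) \<bullet> (Y *v b))"
proof -
  have parseval: "x \<bullet> z = (\<Sum>b\<in>B. (x \<bullet> b) * (z \<bullet> b))" for x z :: "real^'n2"
  proof -
    have "x \<bullet> z = (\<Sum>b\<in>B. (x \<bullet> b) *\<^sub>R b) \<bullet> z"
      using orthonormal_basis_expand[OF B(2,3) _ B(1), of x] B(4) by simp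
    then show ?thesis by (simp add: inner_sum_left inner_commute[of z])
  qed
  have "W \<bullet> Y = (\<Sum>i\<in>UNIV. \<Sum>b\<in>B. (W $ i \<bullet> b) * (Y $ i \<bullet> b))"
    unfolding inner_vec_def[of W Y] by (rule sum.cong) (auto intro: parseval)
  also have "\<dots> = (\<Sum>b\<in>B. \<Sum>i\<in>UNIV. (W $ i \<bullet> b) * (Y $ i \<bullet> b))"
    by (rule sum.swap)
  also have "\<dots> = (\<Sum>b\<in>B. (W *v b) \<bullet> (Y *v b))"
    by (simp add: inner_vec_def[of "W *v _"] matrix_vector_mul_component)
  finally show ?thesis .
qed

text \<open>
  One half of the duality between the spectral and the nuclear norm: apply the Cauchy--Schwarz
  inequality to each vector of a basis of right singular vectors of \<open>Y\<close>.
\<close>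

lemma inner_contraction_le_nuclear_norm:
  fixes W Y :: "real^'n2^'n1"
  assumes W: "\<And>v. norm (W *v v) \<le> norm v"
  shows "W \<bullet> Y \<le> nuclear_norm Y"
proof -
  obtain B where B: "finite B" "pairwise orthogonal B" "\<And>b. b \<in> B \<Longrightarrow> norm b = 1" "span B = UNIV"
    and nuc: "nuclear_norm Y = (\<Sum>b\<in>B. norm (Y *v b))"
    using nuclear_norm_singular_basis[of Y] by metis
  have "W \<bullet> Y = (\<Sum>b\<in>B. (W *v b) \<bullet> (Y *v b))"
    by (rule inner_matrix_orthonormal_basis[OF B])
  also have "\<dots> \<le> (\<Sum>b\<in>B. norm (Y *v b))"
  proof (rule sum_mono)
    fix b assume "b \<in> B"
    have "(W *v b) \<bullet> (Y *v b) \<le> norm (W *v b) * norm (Y *v b)" by (rule norm_cauchy_schwarz)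
    also have "\<dots> \<le> 1 * norm (Y *v b)"
      using W[of b] B(3)[OF \<open>b \<in> B\<close>] by (intro mult_right_mono) auto
    finally show "(W *v b) \<bullet> (Y *v b) \<le> norm (Y *v b)" by simp
  qed
  finally show ?thesis using nuc by simp
qed

text \<open>
  The other half: equality holds for the partial isometry of the polar decomposition, which sends
  each basis vector \<open>b\<close> to the direction of \<open>X *v b\<close> (and to \<open>0\<close> if \<open>X *v b = 0\<close>). It is a
  contraction because the vectors \<open>X *v b\<close> are mutually orthogonal.
\<close>

lemma nuclear_norm_contraction_witness:
  fixes X :: "real^'n2^'n1"
  obtains W :: "real^'n2^'n1" where "\<And>v. norm (W *v v) \<le> norm v" "W \<bullet> X = nuclear_norm X"
proof -
  obtain B where B: "finite B" "pairwise orthogonal B" "\<And>b. b \<in> B \<Longrightarrow> norm b = 1" "span B = UNIV"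
    and images: "pairwise (\<lambda>b c. orthogonal (X *v b) (X *v c)) B"
    and nuc: "nuclear_norm X = (\<Sum>b\<in>B. norm (X *v b))"
    using nuclear_norm_singular_basis[of X] by metis
  define w where "w v = (\<Sum>b\<in>B. (v \<bullet> b) *\<^sub>R sgn (X *v b))" for v
  define W where "W = matrix w"
  have "linear w"
    by (auto simp: linear_iff w_def inner_add_left scaleR_add_left sum.distrib scaleR_sum_right)
  then have W: "W *v v = w v" for v
    unfolding W_def using matrix_works[of w v] by (simp add: linear_matrix_vector_mul_eq)
  have contraction: "norm (w v) \<le> norm v" for v
  proof -
    have "(norm (w v))\<^sup>2 = (\<Sum>b\<in>B. (norm ((v \<bullet> b) *\<^sub>R sgn (X *v b)))\<^sup>2)"
      unfolding w_def
    proof (rule norm_sum_Pythagorean[OF B(1)])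
      show "pairwise (\<lambda>b c. orthogonal ((v \<bullet> b) *\<^sub>R sgn (X *v b)) ((v \<bullet> c) *\<^sub>R sgn (X *v c))) B"
        using images by (auto simp: pairwise_def orthogonal_def sgn_div_norm)
    qed
    also have "\<dots> \<le> (\<Sum>b\<in>B. (norm ((v \<bullet> b) *\<^sub>R b))\<^sup>2)"
      using B(3) by (intro sum_mono power_mono) (auto simp: norm_sgn)
    also have "\<dots> = (norm (\<Sum>b\<in>B. (v \<bullet> b) *\<^sub>R b))\<^sup>2"
      using B(1,2) by (intro norm_sum_Pythagorean[symmetric]) (auto simp: pairwise_def orthogonal_def)
    also have "\<dots> = (norm v)\<^sup>2"
      using orthonormal_basis_expand[OF B(2,3) _ B(1), of v] B(4) by simp
    finally show ?thesis by (simp add: power_mono_iff)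
  qed
  have w_basis: "w b = sgn (X *v b)" if "b \<in> B" for b
  proof -
    have "w b = (\<Sum>c\<in>B. if c = b then sgn (X *v b) else 0)"
      unfolding w_def using that B(2,3)
      by (intro sum.cong) (auto simp: pairwise_def orthogonal_def norm_eq_1)
    then show ?thesis using that B(1) by simp
  qed
  have "W \<bullet> X = (\<Sum>b\<in>B. w b \<bullet> (X *v b))"
    using inner_matrix_orthonormal_basis[OF B, of W X] by (simp add: W)
  also have "\<dots> = nuclear_norm X"
    unfolding nuc
  proof (rule sum.cong)
    fix b assume "b \<in> B"
    then show "w b \<bullet> (X *v b) = norm (X *v b)"
      by (cases "X *v b = 0")
        (simp_all add: w_basis sgn_div_norm power2_norm_eq_inner[symmetric] power2_eq_square)
  qed simp
  finally show ?thesis using that[of W] W contraction by simp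
qed

text \<open>
  A pointwise maximum of linear functionals is convex.
\<close>

lemma convex_on_nuclear_norm: "convex_on UNIV (nuclear_norm :: real^'n2^'n1 \<Rightarrow> real)"
proof (rule convex_onI)
  fix t :: real and X Y :: "real^'n2^'n1"
  assume t: "0 < t" "t < 1"
  let ?Z = "(1 - t) *\<^sub>R X + t *\<^sub>R Y"
  obtain W :: "real^'n2^'n1" where W: "\<And>v. norm (W *v v) \<le> norm v" and "W \<bullet> ?Z = nuclear_norm ?Z"
    using nuclear_norm_contraction_witness[of ?Z] by metis
  then have "nuclear_norm ?Z = (1 - t) * (W \<bullet> X) + t * (W \<bullet> Y)"
    by (simp add: inner_add_right)
  also have "\<dots> \<le> (1 - t) * nuclear_norm X + t * nuclear_norm Y"
    using t inner_contraction_le_nuclear_norm[OF W]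
    by (intro add_mono mult_left_mono) auto
  finally show "nuclear_norm ?Z \<le> (1 - t) * nuclear_norm X + t * nuclear_norm Y" .
qed simp

section \<open>Minimizing a convex function plus half the squared norm\<close>

text \<open>
  A convex function on a Euclidean space is continuous and decreases at most linearly, so half the
  squared norm makes it coercive, and the minimum over a large ball is global.
\<close>

lemma attains_min_convex_plus_half_square:
  fixes c :: "'a::euclidean_space \<Rightarrow> real"
  assumes c: "convex_on UNIV c"
  obtains x where "\<And>z. c x + (norm x)\<^sup>2 / 2 \<le> c z + (norm z)\<^sup>2 / 2"
proof -
  have cont: "continuous_on S c" for S
    using convex_on_continuous[OF open_UNIV c] continuous_on_subset by blast
  obtain u where u: "\<And>z. z \<in> cball 0 1 \<Longrightarrow> c u \<le> c z"
    using continuous_attains_inf[of "cball 0 1" c] cont by fastforce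
  \<comment> \<open>Outside the unit ball, convexity along the ray from \<open>0\<close> gives
    \<open>c z \<ge> c 0 - norm z * (c 0 - c u)\<close>. The quadratic term outweighs the loss beyond twice its slope.\<close>
  define R where "R = 1 + 2 * (c 0 - c u)"
  have "c u \<le> c 0" using u by simp
  then have "R \<ge> 1" by (simp add: R_def)
  have "continuous_on (cball 0 R) (\<lambda>z. c z + (norm z)\<^sup>2 / 2)"
    by (intro continuous_intros cont) auto
  then obtain x where x: "\<And>z. z \<in> cball 0 R \<Longrightarrow> c x + (norm x)\<^sup>2 / 2 \<le> c z + (norm z)\<^sup>2 / 2"
    using continuous_attains_inf[of "cball 0 R" "\<lambda>z. c z + (norm z)\<^sup>2 / 2"] \<open>R \<ge> 1\<close> by fastforce
  have "c x + (norm x)\<^sup>2 / 2 \<le> c z + (norm z)\<^sup>2 / 2" for z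
  proof (cases "norm z \<le> R")
    case False
    let ?r = "norm z"
    have r: "?r > R" "?r > 1" using False \<open>R \<ge> 1\<close> by auto
    have "c u \<le> c ((1 / ?r) *\<^sub>R z)" using r by (intro u) (auto simp: dist_norm)
    also have "\<dots> \<le> (1 - 1 / ?r) * c 0 + (1 / ?r) * c z"
      using convex_onD[OF c, of "1 / ?r" 0 z] r by (simp add: divide_le_eq)
    finally have "?r * c u \<le> ?r * ((1 - 1 / ?r) * c 0 + (1 / ?r) * c z)"
      using r by (intro mult_left_mono) auto
    also have "\<dots> = (?r - 1) * c 0 + c z"
      using r by (simp add: field_simps)
    finally have "c z \<ge> c 0 - ?r * (c 0 - c u)" by (simp add: algebra_simps)
    moreover have "?r * (c 0 - c u) \<le> ?r * (?r / 2)"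
      using r by (intro mult_left_mono) (auto simp: R_def)
    ultimately have "c 0 \<le> c z + ?r\<^sup>2 / 2" by (simp add: power2_eq_square)
    moreover have "c x + (norm x)\<^sup>2 / 2 \<le> c 0" using x[of 0] \<open>R \<ge> 1\<close> by simp
    ultimately show ?thesis by simp
  qed (use x in auto)
  then show ?thesis by (rule that)
qed

text \<open>
  Compare \<open>x\<close> with the point \<open>(1 - t) x + t z\<close>: convexity of \<open>c\<close> and the parallelogram-type
  identity for the squared norm give the claim with the factor \<open>1 - t\<close> in front of the quadratic
  gain, and \<open>t\<close> tends to \<open>0\<close>.
\<close>

lemma quadratic_growth_at_min:
  fixes c :: "'a::real_inner \<Rightarrow> real"
  assumes c: "convex_on UNIV c"
    and min: "\<And>z. c x + (norm x)\<^sup>2 / 2 \<le> c z + (norm z)\<^sup>2 / 2"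
  shows "c x + (norm x)\<^sup>2 / 2 + (norm (z - x))\<^sup>2 / 2 \<le> c z + (norm z)\<^sup>2 / 2"
proof -
  let ?h = "\<lambda>z. c z + (norm z)\<^sup>2 / 2" and ?d = "(norm (z - x))\<^sup>2 / 2"
  have main: "?h x + (1 - t) * ?d \<le> ?h z" if t: "0 < t" "t < 1" for t :: real
  proof -
    let ?p = "(1 - t) *\<^sub>R x + t *\<^sub>R z"
    have sq: "(norm ?p)\<^sup>2 = (1 - t) * (norm x)\<^sup>2 + t * (norm z)\<^sup>2 - t * (1 - t) * (norm (z - x))\<^sup>2"
      unfolding power2_norm_eq_inner
      by (simp add: inner_add_left inner_add_right inner_diff_left inner_diff_right
          inner_commute[of z x]) algebra
    have "c ?p \<le> (1 - t) * c x + t * c z"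
      using convex_onD[OF c, of t x z] t by simp
    then have "?h x \<le> (1 - t) * ?h x + t * ?h z - t * (1 - t) * ?d"
      using min[of ?p] unfolding sq by (simp add: algebra_simps) (simp add: field_simps)
    then have "t * (?h x + (1 - t) * ?d) \<le> t * ?h z"
      by (simp add: algebra_simps add_divide_distrib diff_divide_distrib)
    then show ?thesis using t by simp
  qed
  have "((\<lambda>t. ?h x + (1 - t) * ?d) \<longlongrightarrow> ?h x + (1 - 0) * ?d) (at_right 0)"
    by (intro tendsto_intros)
  moreover have "\<forall>\<^sub>F t in at_right (0::real). ?h x + (1 - t) * ?d \<le> ?h z"
    unfolding eventually_at_right_field using main by (intro exI[of _ 1]) auto
  ultimately show ?thesis
    using tendsto_upperbound[of _ _ "at_right (0::real)"] by fastforce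
qed

section \<open>The Lagrangian and its saddle points\<close>

lemma convex_on_inner_constraint_map:
  fixes f :: "'m::finite \<Rightarrow> real^'n2^'n1 \<Rightarrow> real"
  assumes f: "\<And>i. convex_on UNIV (f i)" and y: "0 \<le> y"
  shows "convex_on UNIV (\<lambda>Z. y \<bullet> constraint_map f Z)"
proof (rule convex_onI)
  fix t :: real and Z W :: "real^'n2^'n1"
  assume t: "0 < t" "t < 1"
  have "y \<bullet> constraint_map f ((1 - t) *\<^sub>R Z + t *\<^sub>R W)
      \<le> (\<Sum>i\<in>UNIV. y $ i * ((1 - t) * f i Z + t * f i W))"
    unfolding inner_vec_def constraint_map_def
    using y t convex_onD[OF f, of t]
    by (auto simp: less_eq_vec_def intro!: sum_mono mult_left_mono)
  also have "\<dots> = (1 - t) * (y \<bullet> constraint_map f Z) + t * (y \<bullet> constraint_map f W)"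
    by (simp add: inner_vec_def constraint_map_def sum_distrib_left sum.distrib[symmetric]
        algebra_simps)
  finally show "y \<bullet> constraint_map f ((1 - t) *\<^sub>R Z + t *\<^sub>R W)
      \<le> (1 - t) * (y \<bullet> constraint_map f Z) + t * (y \<bullet> constraint_map f W)" .
qed simp

lemma convex_on_lagrangian_minus_half_square:
  fixes f :: "'m::finite \<Rightarrow> real^'n2^'n1 \<Rightarrow> real"
  assumes "\<tau> \<ge> 0" "\<And>i. convex_on UNIV (f i)" "0 \<le> y"
  shows "convex_on UNIV (\<lambda>Z. \<tau> * nuclear_norm Z + y \<bullet> constraint_map f Z)"
  using assms by (intro convex_on_add convex_on_cmul convex_on_nuclear_norm
      convex_on_inner_constraint_map)

lemma lagrangian_split:
  "lagrangian \<tau> f Z y = (\<tau> * nuclear_norm Z + y \<bullet> constraint_map f Z) + (norm Z)\<^sup>2 / 2"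
  by (simp add: lagrangian_def f_tau_def)

lemma lagrangian_quadratic_growth:
  fixes f :: "'m::finite \<Rightarrow> real^'n2^'n1 \<Rightarrow> real"
  assumes "\<tau> \<ge> 0" "\<And>i. convex_on UNIV (f i)" "0 \<le> y"
    and "\<And>Z. lagrangian \<tau> f X y \<le> lagrangian \<tau> f Z y"
  shows "lagrangian \<tau> f X y + (norm (Z - X))\<^sup>2 / 2 \<le> lagrangian \<tau> f Z y"
  using quadratic_growth_at_min[OF convex_on_lagrangian_minus_half_square[where f = f and y = y, OF assms(1-3)], of X Z]
    assms(4)
  unfolding lagrangian_split by blast

text \<open>
  A value chosen by \<open>arg_min\<close> is a minimizer only when a minimizer exists, which coercivity provides.
\<close>

lemma arg_min_lagrangian:
  fixes f :: "'m::finite \<Rightarrow> real^'n2^'n1 \<Rightarrow> real"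
  assumes "\<tau> \<ge> 0" "\<And>i. convex_on UNIV (f i)" "0 \<le> y"
    and X: "X = arg_min (\<lambda>Z. f_tau \<tau> Z + y \<bullet> constraint_map f Z) (\<lambda>Z. True)"
  shows "lagrangian \<tau> f X y \<le> lagrangian \<tau> f Z y"
proof -
  obtain X0 where "\<And>Z. lagrangian \<tau> f X0 y \<le> lagrangian \<tau> f Z y"
    using attains_min_convex_plus_half_square[OF convex_on_lagrangian_minus_half_square[where f = f and y = y, OF assms(1-3)]]
    unfolding lagrangian_split by blast
  then have "is_arg_min (\<lambda>Z. lagrangian \<tau> f Z y) (\<lambda>Z. True) X0"
    by (simp add: is_arg_min_linorder)
  then have "is_arg_min (\<lambda>Z. lagrangian \<tau> f Z y) (\<lambda>Z. True) X"
    unfolding X arg_min_def lagrangian_def by (rule someI)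
  then show ?thesis by (simp add: is_arg_min_linorder)
qed

text \<open>
  Each minimizer is tested in the growth inequality of the other one; in the sum of the two
  inequalities the objective values cancel.
\<close>

lemma lagrangian_minimizers_monotone:
  fixes f :: "'m::finite \<Rightarrow> real^'n2^'n1 \<Rightarrow> real"
  assumes "\<tau> \<ge> 0" "\<And>i. convex_on UNIV (f i)" "0 \<le> y" "0 \<le> z"
    and "\<And>Z. lagrangian \<tau> f X y \<le> lagrangian \<tau> f Z y"
    and "\<And>Z. lagrangian \<tau> f W z \<le> lagrangian \<tau> f Z z"
  shows "(y - z) \<bullet> (constraint_map f X - constraint_map f W) \<le> - (norm (X - W))\<^sup>2"
  using lagrangian_quadratic_growth[OF assms(1-3,5), of W]
    lagrangian_quadratic_growth[OF assms(1,2,4,6), of X]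
  by (simp add: lagrangian_def inner_diff_left inner_diff_right norm_minus_commute)

text \<open>
  Primal feasibility and complementary slackness: maximality of \<open>ys\<close> is tested at
  \<open>ys + axis i 1\<close> for the former and at \<open>0\<close> for the latter.
\<close>

lemma saddle_multiplier_conditions:
  fixes f :: "'m::finite \<Rightarrow> real^'n2^'n1 \<Rightarrow> real"
  assumes ys: "0 \<le> ys" and max: "\<And>y. 0 \<le> y \<Longrightarrow> lagrangian \<tau> f Xs y \<le> lagrangian \<tau> f Xs ys"
  shows "f i Xs \<le> 0" "ys $ i * f i Xs = 0"
proof -
  have max': "y \<bullet> constraint_map f Xs \<le> ys \<bullet> constraint_map f Xs" if "0 \<le> y" for y
    using max[OF that] by (simp add: lagrangian_def)
  have neg: "f i Xs \<le> 0" for i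
  proof -
    have "0 \<le> ys + axis i 1"
      using ys by (auto simp: less_eq_vec_def axis_def)
    from max'[OF this] show ?thesis
      by (simp add: inner_add_left inner_axis' constraint_map_def)
  qed
  then show "f i Xs \<le> 0" .
  have "(\<Sum>i\<in>UNIV. ys $ i * f i Xs) \<ge> 0"
    using max'[of 0] by (simp add: inner_vec_def constraint_map_def)
  moreover have nonpos: "ys $ i * f i Xs \<le> 0" for i
    using neg[of i] ys by (simp add: less_eq_vec_def mult_nonneg_nonpos)
  ultimately have "(\<Sum>i\<in>UNIV. - (ys $ i * f i Xs)) = 0"
    using sum_nonpos[of UNIV "\<lambda>i. ys $ i * f i Xs"] by (simp add: sum_negf)
  then have "\<forall>i. - (ys $ i * f i Xs) = 0"
    using nonpos by (subst (asm) sum_nonneg_eq_0_iff) auto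
  then show "ys $ i * f i Xs = 0" by simp
qed

text \<open>
  On feasible points the multiplier term is nonpositive, and it vanishes at \<open>Xs\<close>, so the quadratic
  growth of the Lagrangian at \<open>Xs\<close> becomes quadratic growth of the objective over the feasible set.
\<close>

lemma saddle_point_is_unique_solution:
  fixes f :: "'m::finite \<Rightarrow> real^'n2^'n1 \<Rightarrow> real"
  assumes "\<tau> \<ge> 0" "\<And>i. convex_on UNIV (f i)" and ys: "0 \<le> ys"
    and max: "\<And>y. 0 \<le> y \<Longrightarrow> lagrangian \<tau> f Xs y \<le> lagrangian \<tau> f Xs ys"
    and min: "\<And>Z. lagrangian \<tau> f Xs ys \<le> lagrangian \<tau> f Z ys"
  shows "is_solution \<tau> f W \<longleftrightarrow> W = Xs"
proof -
  have feas: "f i Xs \<le> 0" and compl: "ys $ i * f i Xs = 0" for i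
    using saddle_multiplier_conditions[OF ys max] by auto
  have growth: "f_tau \<tau> Xs + (norm (Z - Xs))\<^sup>2 / 2 \<le> f_tau \<tau> Z" if "\<forall>i. f i Z \<le> 0" for Z
  proof -
    have "ys \<bullet> constraint_map f Z \<le> 0"
      using that ys by (auto simp: inner_vec_def constraint_map_def less_eq_vec_def
          intro!: sum_nonpos mult_nonneg_nonpos)
    moreover have "ys \<bullet> constraint_map f Xs = 0"
      by (simp add: inner_vec_def constraint_map_def compl)
    ultimately show ?thesis
      using lagrangian_quadratic_growth[OF assms(1,2) ys min, of Z] by (simp add: lagrangian_def)
  qed
  have "is_solution \<tau> f Xs"
    unfolding is_solution_def is_arg_min_linorder
  proof (intro conjI allI impI)
    fix Z assume "\<forall>i. f i Z \<le> 0"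
    from growth[OF this] show "f_tau \<tau> Xs \<le> f_tau \<tau> Z"
      using zero_le_power2[of "norm (Z - Xs)"] by argo
  qed (rule feas)
  moreover have "W = Xs" if "is_solution \<tau> f W"
  proof -
    have "\<forall>i. f i W \<le> 0" "f_tau \<tau> W \<le> f_tau \<tau> Xs"
      using that feas by (auto simp: is_solution_def is_arg_min_linorder)
    then have "(norm (W - Xs))\<^sup>2 \<le> 0" using growth[of W] by argo
    then show ?thesis by simp
  qed
  ultimately show ?thesis by blast
qed

section \<open>The dual iteration\<close>

lemma norm_pos_part_diff_le: "norm (pos_part x - pos_part y) \<le> norm (x - y)"
  by (rule norm_le_componentwise_cart) (auto simp: pos_part_def)

lemma pos_part_nonneg: "0 \<le> pos_part x"
  by (simp add: pos_part_def less_eq_vec_def)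

text \<open>
  An active multiplier is not moved, since its constraint value is \<open>0\<close>; a multiplier \<open>0\<close> is moved
  in the nonpositive direction and then cut off at \<open>0\<close> again.
\<close>

lemma pos_part_saddle_multiplier:
  fixes f :: "'m::finite \<Rightarrow> real^'n2^'n1 \<Rightarrow> real"
  assumes "0 \<le> ys" "\<And>i. f i Xs \<le> 0" "\<And>i. ys $ i * f i Xs = 0" "0 \<le> d"
  shows "pos_part (ys + d *\<^sub>R constraint_map f Xs) = ys"
proof -
  have "max (ys $ i + d * f i Xs) 0 = ys $ i" for i
    using assms(1) assms(2,3)[of i] mult_nonneg_nonpos[OF assms(4) assms(2)[of i]]
    by (auto simp: less_eq_vec_def max_def intro: antisym)
  then show ?thesis by (simp add: vec_eq_iff pos_part_def constraint_map_def)
qed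

text \<open>
  The extended real infimum and supremum are replaced by real bounds. Both given inequalities are
  strict, so there is a real number in each gap, also when the upper end is \<open>\<infinity>\<close>.
\<close>

lemma real_bounds_of_step_sizes:
  fixes \<delta> :: "nat \<Rightarrow> real"
  assumes "0 < (INF k\<in>{1..}. ereal (\<delta> k))"
    and "(SUP k\<in>{1..}. ereal (\<delta> k)) < (if L = 0 then \<infinity> else ereal (2 / L\<^sup>2))"
  obtains a b where "0 < a" "\<And>k. k \<ge> 1 \<Longrightarrow> a \<le> \<delta> k" "\<And>k. k \<ge> 1 \<Longrightarrow> \<delta> k \<le> b" "b * L\<^sup>2 < 2"
proof -
  obtain a where a: "0 < ereal a" "ereal a < (INF k\<in>{1..}. ereal (\<delta> k))"
    using ereal_dense2[OF assms(1)] by (auto simp: zero_ereal_def)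
  have lower: "a \<le> \<delta> k" if "k \<ge> 1" for k
  proof -
    have "(INF k\<in>{1..}. ereal (\<delta> k)) \<le> ereal (\<delta> k)" using that by (intro INF_lower) auto
    with a(2) have "ereal a < ereal (\<delta> k)" by (rule less_le_trans)
    then show ?thesis by simp
  qed
  obtain b where b: "(SUP k\<in>{1..}. ereal (\<delta> k)) < ereal b"
      "ereal b < (if L = 0 then \<infinity> else ereal (2 / L\<^sup>2))"
    using ereal_dense2[OF assms(2)] by blast
  have upper: "\<delta> k \<le> b" if "k \<ge> 1" for k
  proof -
    have "ereal (\<delta> k) \<le> (SUP k\<in>{1..}. ereal (\<delta> k))" using that by (intro SUP_upper) auto
    then have "ereal (\<delta> k) < ereal b" using b(1) by (rule le_less_trans)
    then show ?thesis by simp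
  qed
  have "b * L\<^sup>2 < 2"
    using b(2) by (cases "L = 0") (auto simp: pos_less_divide_eq)
  moreover have "0 < a" using a(1) by simp
  ultimately show ?thesis using that[of a b] lower upper by blast
qed

lemma tendsto_zero_if_bounded_by_decrease:
  fixes D e :: "nat \<Rightarrow> real"
  assumes D: "\<And>n. 0 \<le> D n" and e: "\<And>n. 0 \<le> e n"
    and dec: "\<And>n. D (Suc n) + e n \<le> D n"
  shows "e \<longlonglongrightarrow> 0"
proof -
  have "decseq D" using dec e by (intro decseq_SucI) (smt (verit))
  then obtain l where "D \<longlonglongrightarrow> l"
    using decseq_convergent[of D 0] D by blast
  then have "(\<lambda>n. D n - D (Suc n)) \<longlonglongrightarrow> l - l"
    by (intro tendsto_diff LIMSEQ_Suc)
  then have "(\<lambda>n. D n - D (Suc n)) \<longlonglongrightarrow> 0" by simp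
  then show ?thesis
    using e dec by (intro tendsto_sandwich[OF _ _ tendsto_const, of 0 e sequentially]) (auto simp: algebra_simps)
qed

text \<open>
  Comparing the updates of \<open>y\<close> at \<open>X\<close> and of \<open>ys\<close> at \<open>Xs\<close>: the cross term of the expanded
  square contributes \<open>- 2 * d * (norm (X - Xs))\<^sup>2\<close> by monotonicity, and the Lipschitz condition
  bounds the quadratic term by \<open>d\<^sup>2 * L\<^sup>2 * (norm (X - Xs))\<^sup>2\<close>.
\<close>

lemma dual_step_distance:
  fixes f :: "'m::finite \<Rightarrow> real^'n2^'n1 \<Rightarrow> real"
  assumes lip: "L-lipschitz_on UNIV (constraint_map f)" and "0 \<le> d"
    and mono: "(y - ys) \<bullet> (constraint_map f X - constraint_map f Xs) \<le> - (norm (X - Xs))\<^sup>2"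
    and fix_ys: "pos_part (ys + d *\<^sub>R constraint_map f Xs) = ys"
  shows "(norm (pos_part (y + d *\<^sub>R constraint_map f X) - ys))\<^sup>2
      + d * (2 - d * L\<^sup>2) * (norm (X - Xs))\<^sup>2 \<le> (norm (y - ys))\<^sup>2"
proof -
  let ?F = "constraint_map f X - constraint_map f Xs"
  have "norm (pos_part (y + d *\<^sub>R constraint_map f X) - ys) \<le> norm ((y - ys) + d *\<^sub>R ?F)"
    using norm_pos_part_diff_le[of "y + d *\<^sub>R constraint_map f X" "ys + d *\<^sub>R constraint_map f Xs"]
    unfolding fix_ys by (simp add: algebra_simps)
  then have "(norm (pos_part (y + d *\<^sub>R constraint_map f X) - ys))\<^sup>2 \<le> (norm ((y - ys) + d *\<^sub>R ?F))\<^sup>2"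
    by (intro power_mono) auto
  also have "\<dots> = (norm (y - ys))\<^sup>2 + 2 * d * ((y - ys) \<bullet> ?F) + d\<^sup>2 * (norm ?F)\<^sup>2"
    unfolding power2_norm_eq_inner[of "(y - ys) + _"] power2_norm_eq_inner[of "y - ys"] power2_norm_eq_inner[of "?F"]
      inner_add_left inner_add_right inner_scaleR_left inner_scaleR_right inner_commute[of ?F "y - ys"]
    by (simp add: power2_eq_square algebra_simps)
  also have "\<dots> \<le> (norm (y - ys))\<^sup>2 + 2 * d * (- (norm (X - Xs))\<^sup>2) + d\<^sup>2 * (L * norm (X - Xs))\<^sup>2"
    using mono \<open>0 \<le> d\<close> lipschitz_onD[OF lip, of X Xs]
    by (intro add_mono mult_left_mono power_mono) (auto simp: dist_norm)
  finally show ?thesis by (simp add: power_mult_distrib power2_eq_square algebra_simps)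
qed

theorem theorem4p4:
  fixes \<tau> L :: real
    and f :: "'m::finite \<Rightarrow> real^'n2^'n1 \<Rightarrow> real"
    and \<delta> :: "nat \<Rightarrow> real"
    and X :: "nat \<Rightarrow> real^'n2^'n1"
    and y :: "nat \<Rightarrow> real^'m"
  assumes "\<tau> > 0"
    and "\<And>i. convex_on UNIV (f i)"
    and "L-lipschitz_on UNIV (constraint_map f)"
    and "strong_duality \<tau> f"
    and "0 < (INF k\<in>{1..}. ereal (\<delta> k))"
    and "(SUP k\<in>{1..}. ereal (\<delta> k)) < (if L = 0 then \<infinity> else ereal (2 / L\<^sup>2))"
    and "y 0 = 0"
    and "\<And>k. k \<ge> 1 \<Longrightarrow> X k = arg_min (\<lambda>Z. f_tau \<tau> Z + y (k - 1) \<bullet> constraint_map f Z) (\<lambda>Z. True)"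
    and "\<And>k. k \<ge> 1 \<Longrightarrow> y k = pos_part (y (k - 1) + \<delta> k *\<^sub>R constraint_map f (X k))"
  shows "\<exists>Z. is_solution \<tau> f Z \<and> (\<forall>W. is_solution \<tau> f W \<longrightarrow> W = Z) \<and> X \<longlonglongrightarrow> Z"
proof -
  note \<tau> = less_imp_le[OF assms(1)] and cvx = assms(2)
  obtain Xs ys where ys: "0 \<le> ys"
    and max: "\<And>y. 0 \<le> y \<Longrightarrow> lagrangian \<tau> f Xs y \<le> lagrangian \<tau> f Xs ys"
    and min: "\<And>Z. lagrangian \<tau> f Xs ys \<le> lagrangian \<tau> f Z ys"
    using assms(4) unfolding strong_duality_def by blast
  have feas: "f i Xs \<le> 0" and compl: "ys $ i * f i Xs = 0" for i
    using saddle_multiplier_conditions[OF ys max] by auto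
  obtain a b where a: "0 < a" and \<delta>: "\<And>k. k \<ge> 1 \<Longrightarrow> a \<le> \<delta> k" "\<And>k. k \<ge> 1 \<Longrightarrow> \<delta> k \<le> b"
    and b: "b * L\<^sup>2 < 2"
    using real_bounds_of_step_sizes[OF assms(5,6)] by blast
  have y_nonneg: "0 \<le> y n" for n
    using assms(7) assms(9)[of n] pos_part_nonneg by (cases n) auto
  have X_min: "lagrangian \<tau> f (X (Suc n)) (y n) \<le> lagrangian \<tau> f Z (y n)" for n Z
    using assms(8)[of "Suc n"] by (intro arg_min_lagrangian[OF \<tau> cvx y_nonneg]) simp_all
  \<comment> \<open>The guaranteed decrease of the squared multiplier distance, uniform in the step size.\<close>
  define e where "e n = a * (2 - b * L\<^sup>2) * (norm (X (Suc n) - Xs))\<^sup>2" for n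
  have "(norm (y (Suc n) - ys))\<^sup>2 + e n \<le> (norm (y n - ys))\<^sup>2" for n
  proof -
    let ?d = "\<delta> (Suc n)"
    have d: "a \<le> ?d" "?d \<le> b" using \<delta> by auto
    then have "0 \<le> ?d" using a by simp
    have "(norm (y (Suc n) - ys))\<^sup>2 + ?d * (2 - ?d * L\<^sup>2) * (norm (X (Suc n) - Xs))\<^sup>2
        \<le> (norm (y n - ys))\<^sup>2"
      using dual_step_distance[OF assms(3) \<open>0 \<le> ?d\<close>
          lagrangian_minimizers_monotone[OF \<tau> cvx y_nonneg ys X_min min]
          pos_part_saddle_multiplier[where f = f, OF ys feas compl \<open>0 \<le> ?d\<close>]]
        assms(9)[of "Suc n"] by simp
    moreover have "?d * L\<^sup>2 \<le> b * L\<^sup>2" using d by (intro mult_right_mono) auto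
    then have "e n \<le> ?d * (2 - ?d * L\<^sup>2) * (norm (X (Suc n) - Xs))\<^sup>2"
      unfolding e_def using a b d by (intro mult_right_mono mult_mono) auto
    ultimately show ?thesis by simp
  qed
  then have "e \<longlonglongrightarrow> 0"
    using a b by (intro tendsto_zero_if_bounded_by_decrease[of "\<lambda>n. (norm (y n - ys))\<^sup>2" e])
      (auto simp: e_def)
  then have "(\<lambda>n. e n / (a * (2 - b * L\<^sup>2))) \<longlonglongrightarrow> 0"
    by (rule tendsto_divide_zero)
  then have "(\<lambda>n. (norm (X (Suc n) - Xs))\<^sup>2) \<longlonglongrightarrow> 0"
    using a b by (simp add: e_def)
  then have "(\<lambda>n. sqrt ((norm (X (Suc n) - Xs))\<^sup>2)) \<longlonglongrightarrow> sqrt 0"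
    by (rule tendsto_real_sqrt)
  then have "(\<lambda>n. X (Suc n)) \<longlonglongrightarrow> Xs"
    by (simp add: tendsto_norm_zero_iff LIM_zero_iff)
  then have "X \<longlonglongrightarrow> Xs" by (rule LIMSEQ_imp_Suc)
  then show ?thesis
    using saddle_point_is_unique_solution[OF \<tau> cvx ys max min] by blast
qed

end
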